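(* Let $d\ge 1$, $\sigma>0$, let $P$ be a Borel probability measure on $\mathbb{R}^d$, let $X_1,X_2,\dots$ be i.i.d. with distribution $P$, and let $P_n=n^{-1}\sum_{i=1}^n\delta_{X_i}$. Suppose that $$\int_{\mathbb{R}^{d}} \sqrt{\mathrm{Var}_{P}(\varphi_\sigma(x-\cdot))}\,dx < \infty .$$ Then, for every $n\ge 1$, $$\mathbb{P}\bigg (\delta_{\mathsf{TV}}^{(\sigma)}(P_n,P) \ge \mathbb{E}\Big[\delta_{\mathsf{TV}}^{(\sigma)}(P_n,P)\Big] + t \bigg) \le e^{-nt^{2}/2},\quad\forall t > 0 .$$
   Context: $\varphi_\sigma(x)=(2\pi\sigma^2)^{-d/2}e^{-\|x\|^2/(2\sigma^2)}$, $x\in\mathbb{R}^d$, is the density of $\mathcal{N}_\sigma:=\mathcal{N}(0,\sigma^2 \mathrm{I}_d)$, and $\|\cdot\|$ is the Euclidean norm. $\ast$ denotes convolution of probability measures. The total variation distance is $\delta_{\mathsf{TV}}(P,Q)=\sup_{A}|P(A)-Q(A)|$, the supremum being over Borel sets $A\subseteq\mathbb{R}^d$, and its smooth version is $\delta_{\mathsf{TV}}^{(\sigma)}(P,Q):=\delta_{\mathsf{TV}}(P\ast\mathcal{N}_\sigma,Q\ast\mathcal{N}_\sigma)$. $\mathrm{Var}_P(\varphi_\sigma(x-\cdot))=\mathrm{Var}(\varphi_\sigma(x-X))$ for $X\sim P$. *)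

theory Defs
  imports "HOL-Probability.Probability"
begin

definition gauss_dens :: "real \<Rightarrow> real ^ 'd \<Rightarrow> real" where
  "gauss_dens \<sigma> x =
     (2 * pi * \<sigma>\<^sup>2) powr (- real CARD('d) / 2) * exp (- (norm x)\<^sup>2 / (2 * \<sigma>\<^sup>2))"

definition gauss_measure :: "real \<Rightarrow> (real ^ 'd) measure" where
  "gauss_measure \<sigma> = density lborel (\<lambda>x. ennreal (gauss_dens \<sigma> x))"

text \<open>
  For finite measures the set of differences is bounded, so the real-valued supremum is the
  mathematical one.
\<close>

definition tv_dist :: "(real ^ 'd) measure \<Rightarrow> (real ^ 'd) measure \<Rightarrow> real" where
  "tv_dist P Q = (SUP A \<in> sets borel. \<bar>measure P A - measure Q A\<bar>)"

definition smooth_tv :: "real \<Rightarrow> (real ^ 'd) measure \<Rightarrow> (real ^ 'd) measure \<Rightarrow> real" where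
  "smooth_tv \<sigma> P Q = tv_dist (P \<star> gauss_measure \<sigma>) (Q \<star> gauss_measure \<sigma>)"

definition empirical :: "nat \<Rightarrow> (nat \<Rightarrow> real ^ 'd) \<Rightarrow> (real ^ 'd) measure" where
  "empirical n x =
     measure_of UNIV (sets borel) (\<lambda>A. (\<Sum>i<n. emeasure (return borel (x i)) A) / of_nat n)"

text \<open>
  \<^const>\<open>measure_of\<close> yields the null measure unless the given set function is a measure, so its
  value is checked here.
\<close>

lemma space_empirical [simp]: "space (empirical n x) = UNIV"
  by (simp add: empirical_def space_measure_of_conv)

lemma sets_empirical [simp, measurable_cong]: "sets (empirical n x) = sets borel"
  by (simp add: empirical_def sets_measure_of_conv sets.sigma_sets_eq[of borel, simplified])

lemma emeasure_empirical:
  fixes x :: "nat \<Rightarrow> real ^ 'd"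
  assumes "A \<in> sets borel"
  shows "emeasure (empirical n x) A = (\<Sum>i<n. emeasure (return borel (x i)) A) / of_nat n"
proof (rule emeasure_measure_of[OF empirical_def])
  show "countably_additive (sets (empirical n x))
     (\<lambda>A. (\<Sum>i<n. emeasure (return borel (x i)) A) / of_nat n)"
  proof (rule countably_additiveI)
    fix B :: "nat \<Rightarrow> (real ^ 'd) set"
    assume B: "range B \<subseteq> sets (empirical n x)" "disjoint_family B"
    have "(\<Sum>k. (\<Sum>i<n. emeasure (return borel (x i)) (B k)) / of_nat n)
        = (\<Sum>k. \<Sum>i<n. emeasure (return borel (x i)) (B k)) / of_nat n"
      by (simp add: divide_ennreal_def)
    also have "(\<Sum>k. \<Sum>i<n. emeasure (return borel (x i)) (B k))
        = (\<Sum>i<n. \<Sum>k. emeasure (return borel (x i)) (B k))"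
      by (rule suminf_sum) simp
    also have "\<dots> = (\<Sum>i<n. emeasure (return borel (x i)) (\<Union> (range B)))"
      using B by (intro sum.cong refl suminf_emeasure) auto
    finally show "(\<Sum>k. (\<Sum>i<n. emeasure (return borel (x i)) (B k)) / of_nat n)
        = (\<Sum>i<n. emeasure (return borel (x i)) (\<Union> (range B))) / of_nat n" .
  qed
qed (use assms in \<open>auto simp: positive_def\<close>)

end

theory Submission
  imports Defs
begin

text \<open>
  The smoothed total variation is the integral of the positive part of the difference of the smoothed
  densities, so replacing one sample point changes it by at most \<open>1 / n\<close>, and McDiarmid's
  inequality gives the bound \<open>exp (- 2 n t\<^sup>2)\<close>. McDiarmid's inequality follows by bounding the
  moment generating function one coordinate at a time: integrating out a coordinate preserves the
  bounded differences in the others, and Hoeffding's lemma controls what is lost.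
\<close>

section \<open>McDiarmid's inequality\<close>

text \<open>With \<open>g\<close> the mean of \<open>f\<close> over coordinate \<open>i\<close>, the
  exponent splits into multiples of \<open>f - g\<close> and of \<open>g\<close> minus its mean. The
  first factor integrates over coordinate \<open>i\<close> to at most
  \<open>exp (l^2 * (c i)^2 / 8)\<close>, uniformly in the remaining coordinates, and the induction
  hypothesis for \<open>g\<close> treats the second. With nonnegative integrals, Tonelli applies to
  the exponentials directly.\<close>

lemma bounded_differences_mgf:
  fixes f :: "('i \<Rightarrow> 'a) \<Rightarrow> real"
  assumes "finite I" and N: "\<And>i. prob_space (N i)" and l: "l > 0"
    and "f \<in> borel_measurable (PiM I N)"
    and "\<And>x. x \<in> space (PiM I N) \<Longrightarrow> \<bar>f x\<bar> \<le> B"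
    and "\<And>x i y. x \<in> space (PiM I N) \<Longrightarrow> i \<in> I \<Longrightarrow> y \<in> space (N i) \<Longrightarrow>
           \<bar>f x - f (x(i := y))\<bar> \<le> c i"
  shows "(\<integral>\<^sup>+x. ennreal (exp (l * (f x - integral\<^sup>L (PiM I N) f))) \<partial>PiM I N)
           \<le> ennreal (exp (l\<^sup>2 * (\<Sum>i\<in>I. (c i)\<^sup>2) / 8))"
  using assms(1,4-)
proof (induction I arbitrary: f rule: finite_induct)
  \<comment> \<open>The empty product has a single point, the function that is
    \<open>undefined\<close> everywhere, so \<open>f\<close> equals its own mean.\<close>
  case empty
  have "prob_space (PiM {} N)" by (intro prob_space_PiM N)
  then interpret E: prob_space "PiM {} N" .
  have "integral\<^sup>L (PiM {} N) f = integral\<^sup>L (PiM {} N) (\<lambda>_. f (\<lambda>_. undefined))"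
    by (intro Bochner_Integration.integral_cong) (auto simp: space_PiM)
  also have "\<dots> = f (\<lambda>_. undefined)" using E.prob_space by simp
  finally have "(\<integral>\<^sup>+x. ennreal (exp (l * (f x - integral\<^sup>L (PiM {} N) f))) \<partial>PiM {} N)
     = (\<integral>\<^sup>+x. 1 \<partial>PiM {} N)"
    by (intro nn_integral_cong) (auto simp: space_PiM)
  then show ?case by (simp add: E.emeasure_space_1)
next
  case (insert i I)
  interpret Ni: prob_space "N i" by (rule N)
  interpret product_prob_space N UNIV by (intro product_prob_spaceI N)
  have "prob_space (PiM (insert i I) N)" by (intro prob_space_PiM N)
  then interpret E: prob_space "PiM (insert i I) N" .
  have "prob_space (PiM I N)" by (intro prob_space_PiM N)
  then interpret EI: prob_space "PiM I N" .
  note [measurable] = insert.prems(1)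
  have upd: "x(i := y) \<in> space (PiM (insert i I) N)"
    if "x \<in> space (PiM I N)" "y \<in> space (N i)" for x y
    using that by (auto simp: space_PiM PiE_iff extensional_def)
  have upd_meas [measurable]: "(\<lambda>(x, y). x(i := y)) \<in> PiM I N \<Otimes>\<^sub>M N i \<rightarrow>\<^sub>M PiM (insert i I) N"
    by (rule measurable_add_dim)
  have f_upd: "(\<lambda>(x, y). f (x(i := y))) \<in> borel_measurable (PiM I N \<Otimes>\<^sub>M N i)"
    using measurable_compose[OF upd_meas insert.prems(1)] by (simp add: case_prod_beta)
  have f_x: "(\<lambda>y. f (x(i := y))) \<in> borel_measurable (N i)" if "x \<in> space (PiM I N)" for x
    using measurable_compose[OF measurable_Pair1'[OF that] f_upd] by simp
  have int_x: "integrable (N i) (\<lambda>y. f (x(i := y)))" if "x \<in> space (PiM I N)" for x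
    by (rule Ni.integrable_const_bound[where B = B])
       (use that f_x insert.prems(2) upd in \<open>auto intro!: AE_I2\<close>)
  have int_f: "integrable (PiM (insert i I) N) f"
    by (rule E.integrable_const_bound[where B = B]) (use insert.prems(2) in \<open>auto intro!: AE_I2\<close>)
  \<comment> \<open>This is the conditional expectation of \<open>f\<close> given the coordinates in
    \<open>I\<close>.\<close>
  define g where "g x = (\<integral>y. f (x(i := y)) \<partial>N i)" for x
  have g_meas [measurable]: "g \<in> borel_measurable (PiM I N)"
    unfolding g_def by (rule Ni.borel_measurable_lebesgue_integral[OF f_upd])
  have Eg: "integral\<^sup>L (PiM (insert i I) N) f = integral\<^sup>L (PiM I N) g"
    unfolding g_def by (rule product_integral_insert[OF insert.hyps(1,2) int_f])
  have g_bound: "\<bar>g x\<bar> \<le> B" if x: "x \<in> space (PiM I N)" for x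
  proof -
    have "\<bar>g x\<bar> \<le> (\<integral>y. \<bar>f (x(i := y))\<bar> \<partial>N i)"
      unfolding g_def by (rule integral_abs_bound)
    also have "\<dots> \<le> (\<integral>y. B \<partial>N i)"
      using int_x[OF x] x upd insert.prems(2) by (intro integral_mono) auto
    finally show ?thesis by (simp add: Ni.prob_space)
  qed
  \<comment> \<open>As \<open>i \<noteq> j\<close>, the updates at \<open>i\<close> and
    \<open>j\<close> commute, so for each fixed \<open>y\<close> the integrand is a difference of
    \<open>f\<close> in coordinate \<open>j\<close> alone.\<close>
  have g_diff: "\<bar>g x - g (x(j := z))\<bar> \<le> c j"
    if x: "x \<in> space (PiM I N)" and j: "j \<in> I" and z: "z \<in> space (N j)" for x j z
  proof -
    have xz: "x(j := z) \<in> space (PiM I N)"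
      using x j z by (auto simp: space_PiM PiE_iff extensional_def)
    have "i \<noteq> j" using j insert.hyps by auto
    have "\<bar>g x - g (x(j := z))\<bar> = \<bar>\<integral>y. f (x(i := y)) - f (x(j := z, i := y)) \<partial>N i\<bar>"
      unfolding g_def by (subst Bochner_Integration.integral_diff) (use int_x x xz in auto)
    also have "\<dots> \<le> (\<integral>y. \<bar>f (x(i := y)) - f (x(j := z, i := y))\<bar> \<partial>N i)"
      by (rule integral_abs_bound)
    also have "\<dots> \<le> (\<integral>y. c j \<partial>N i)"
    proof (intro integral_mono)
      fix y assume y: "y \<in> space (N i)"
      show "\<bar>f (x(i := y)) - f (x(j := z, i := y))\<bar> \<le> c j"
        using insert.prems(3)[OF upd[OF x y], of j z] j z
        unfolding fun_upd_twist[OF \<open>i \<noteq> j\<close>, of x y z] by blast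
    qed (use int_x x xz in auto)
    finally show ?thesis by (simp add: Ni.prob_space)
  qed
  have inner: "(\<integral>\<^sup>+y. ennreal (exp (l * (f (x(i := y)) - g x))) \<partial>N i)
      \<le> ennreal (exp (l\<^sup>2 * (c i)\<^sup>2 / 8))" if x: "x \<in> space (PiM I N)" for x
  proof -
    \<comment> \<open>Any two values of \<open>f\<close> along coordinate \<open>i\<close> differ by
      at most \<open>c i\<close>, so they all lie in the interval of length \<open>c i\<close> that
      starts at their infimum. Hoeffding's lemma on an interval of this length produces the
      denominator 8; the mean it subtracts is \<open>g x\<close>.\<close>
    define a where "a = (INF y\<in>space (N i). f (x(i := y)))"
    have ne: "space (N i) \<noteq> {}" by (rule Ni.not_empty)
    have bdd: "bdd_below ((\<lambda>y. f (x(i := y))) ` space (N i))"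
      using upd[OF x] insert.prems(2) by (intro bdd_belowI2[where m = "-B"]) force
    have "interval_bounded_random_variable (N i) (\<lambda>y. f (x(i := y))) a (a + c i)"
    proof (intro interval_bounded_random_variable.intro Ni.prob_space_axioms
        interval_bounded_random_variable_axioms.intro f_x x AE_I2)
      fix y assume y: "y \<in> space (N i)"
      have "f (x(i := y)) - c i \<le> a"
        unfolding a_def
      proof (rule cINF_greatest[OF ne])
        fix y' assume "y' \<in> space (N i)"
        then have "\<bar>f (x(i := y)) - f (x(i := y'))\<bar> \<le> c i"
          using insert.prems(3)[OF upd[OF x y], of i y'] by (simp only: fun_upd_upd insertI1)
        then show "f (x(i := y)) - c i \<le> f (x(i := y'))" by linarith
      qed
      moreover have "a \<le> f (x(i := y))"
        unfolding a_def by (rule cINF_lower[OF bdd y])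
      ultimately show "f (x(i := y)) \<in> {a..a + c i}" by auto
    qed
    from interval_bounded_random_variable.Hoeffdings_lemma_nn_integral[OF this l]
    show ?thesis by (simp add: g_def)
  qed
  have "(\<integral>\<^sup>+x. ennreal (exp (l * (f x - integral\<^sup>L (PiM (insert i I) N) f))) \<partial>PiM (insert i I) N)
     = (\<integral>\<^sup>+x. \<integral>\<^sup>+y. ennreal (exp (l * (f (x(i := y)) - integral\<^sup>L (PiM I N) g))) \<partial>N i \<partial>PiM I N)"
    unfolding Eg by (rule product_nn_integral_insert) (use insert.hyps in auto)
  also have "\<dots> = (\<integral>\<^sup>+x. ennreal (exp (l * (g x - integral\<^sup>L (PiM I N) g)))
                    * (\<integral>\<^sup>+y. ennreal (exp (l * (f (x(i := y)) - g x))) \<partial>N i) \<partial>PiM I N)"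
  proof (intro nn_integral_cong)
    fix x assume x: "x \<in> space (PiM I N)"
    note [measurable] = f_x[OF x]
    show "(\<integral>\<^sup>+y. ennreal (exp (l * (f (x(i := y)) - integral\<^sup>L (PiM I N) g))) \<partial>N i)
      = ennreal (exp (l * (g x - integral\<^sup>L (PiM I N) g)))
                    * (\<integral>\<^sup>+y. ennreal (exp (l * (f (x(i := y)) - g x))) \<partial>N i)"
      by (subst nn_integral_cmult[symmetric])
         (auto intro!: nn_integral_cong simp: ennreal_mult'[symmetric] exp_add[symmetric] algebra_simps)
  qed
  also have "\<dots> \<le> (\<integral>\<^sup>+x. ennreal (exp (l * (g x - integral\<^sup>L (PiM I N) g)))
                    * ennreal (exp (l\<^sup>2 * (c i)\<^sup>2 / 8)) \<partial>PiM I N)"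
    by (intro nn_integral_mono mult_left_mono inner) auto
  also have "\<dots> = (\<integral>\<^sup>+x. ennreal (exp (l * (g x - integral\<^sup>L (PiM I N) g))) \<partial>PiM I N)
                    * ennreal (exp (l\<^sup>2 * (c i)\<^sup>2 / 8))"
    by (rule nn_integral_multc) measurable
  also have "\<dots> \<le> ennreal (exp (l\<^sup>2 * (\<Sum>i\<in>I. (c i)\<^sup>2) / 8)) * ennreal (exp (l\<^sup>2 * (c i)\<^sup>2 / 8))"
    by (intro mult_right_mono insert.IH g_meas g_bound g_diff) auto
  also have "\<dots> = ennreal (exp (l\<^sup>2 * (\<Sum>i\<in>insert i I. (c i)\<^sup>2) / 8))"
    using insert.hyps
    by (simp add: ennreal_mult'[symmetric] exp_add[symmetric] algebra_simps add_divide_distrib)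
  finally show ?case .
qed

text \<open>The exponential Markov inequality turns the bound on the moment generating function into
  a tail bound, with \<open>l\<close> chosen optimally.\<close>

theorem McDiarmid_ineq_PiM:
  fixes f :: "('i \<Rightarrow> 'a) \<Rightarrow> real"
  assumes I: "finite I" and N: "\<And>i. prob_space (N i)"
    and f: "f \<in> borel_measurable (PiM I N)"
    and B: "\<And>x. x \<in> space (PiM I N) \<Longrightarrow> \<bar>f x\<bar> \<le> B"
    and c: "\<And>x i y. x \<in> space (PiM I N) \<Longrightarrow> i \<in> I \<Longrightarrow> y \<in> space (N i) \<Longrightarrow>
           \<bar>f x - f (x(i := y))\<bar> \<le> c i"
    and pos: "(\<Sum>i\<in>I. (c i)\<^sup>2) > 0" and t: "t > 0"
  shows "measure (PiM I N) {x \<in> space (PiM I N). f x \<ge> integral\<^sup>L (PiM I N) f + t}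
           \<le> exp (- 2 * t\<^sup>2 / (\<Sum>i\<in>I. (c i)\<^sup>2))"
proof -
  have "prob_space (PiM I N)" by (intro prob_space_PiM N)
  then interpret prob_space "PiM I N" .
  note [measurable] = f
  define d where "d = (\<Sum>i\<in>I. (c i)\<^sup>2)"
  \<comment> \<open>This value minimises \<open>- l * t + l^2 * d / 8\<close>; the minimum is
    \<open>- 2 * t^2 / d\<close>.\<close>
  define l where "l = 4 * t / d"
  have d: "d > 0" and l: "l > 0" using pos t by (auto simp: d_def l_def)
  have "ennreal (prob {x \<in> space (PiM I N). f x \<ge> expectation f + t})
      = emeasure (PiM I N) {x \<in> space (PiM I N). f x - expectation f \<ge> t}"
    by (simp add: emeasure_eq_measure algebra_simps)
  also have "\<dots> \<le> ennreal (exp (- l * t)) *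
      (\<integral>\<^sup>+x. ennreal (exp (l * (f x - expectation f))) * indicator (space (PiM I N)) x \<partial>PiM I N)"
    by (intro Chernoff_ineq_nn_integral_ge l) auto
  also have "(\<integral>\<^sup>+x. ennreal (exp (l * (f x - expectation f))) * indicator (space (PiM I N)) x \<partial>PiM I N)
      = (\<integral>\<^sup>+x. ennreal (exp (l * (f x - expectation f))) \<partial>PiM I N)"
    by (intro nn_integral_cong) auto
  also have "ennreal (exp (- l * t)) * \<dots> \<le> ennreal (exp (- l * t)) * ennreal (exp (l\<^sup>2 * d / 8))"
    unfolding d_def by (intro mult_left_mono bounded_differences_mgf[where B = B] I N l f B c) auto
  also have "\<dots> = ennreal (exp (- l * t + l\<^sup>2 * d / 8))"
    by (simp only: ennreal_mult'[symmetric] exp_add[symmetric] exp_ge_zero)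
  also have "- l * t + l\<^sup>2 * d / 8 = - 2 * t\<^sup>2 / d"
    using d by (simp add: l_def field_simps power2_eq_square)
  finally show ?thesis by (simp add: d_def)
qed

section \<open>Total variation and Gaussian smoothing\<close>

text \<open>As the two densities have the same mass, \<open>P A - Q A\<close> and \<open>Q A - P A\<close> have the same
  supremum, namely the integral of the positive part, attained on \<open>{p > q}\<close>.\<close>

lemma tv_dist_density:
  fixes p q :: "real ^ 'd \<Rightarrow> real"
  assumes p: "integrable lborel p" "\<And>z. p z \<ge> 0"
    and q: "integrable lborel q" "\<And>z. q z \<ge> 0"
    and eq: "integral\<^sup>L lborel p = integral\<^sup>L lborel q"
  shows "tv_dist (density lborel (\<lambda>z. ennreal (p z))) (density lborel (\<lambda>z. ennreal (q z)))
           = (\<integral>z. max 0 (p z - q z) \<partial>lborel)"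
proof -
  have [measurable]: "p \<in> borel_measurable borel" "q \<in> borel_measurable borel"
    using p(1) q(1) by (auto dest: borel_measurable_integrable)
  define r where "r z = p z - q z" for z
  have r: "integrable lborel r" unfolding r_def using p q by auto
  have [measurable]: "r \<in> borel_measurable borel" unfolding r_def by measurable
  have r0: "(\<integral>z. r z \<partial>lborel) = 0" unfolding r_def using p q eq by simp
  have meas: "measure (density lborel (\<lambda>z. ennreal (h z))) A = (\<integral>z. h z * indicator A z \<partial>lborel)"
    if h: "integrable lborel h" "\<And>z. h z \<ge> 0" and [measurable]: "A \<in> sets borel"
    for h :: "real ^ 'd \<Rightarrow> real" and A
  proof -
    have [measurable]: "h \<in> borel_measurable borel"
      using h(1) by (auto dest: borel_measurable_integrable)
    have "emeasure (density lborel (\<lambda>z. ennreal (h z))) A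
        = (\<integral>\<^sup>+z. ennreal (h z * indicator A z) \<partial>lborel)"
      by (subst emeasure_density) (auto intro!: nn_integral_cong simp: indicator_def)
    also have "\<dots> = ennreal (\<integral>z. h z * indicator A z \<partial>lborel)"
      using h by (intro nn_integral_eq_integral integrable_real_mult_indicator) auto
    finally show ?thesis
      using h by (simp add: measure_def)
  qed
  have diff: "measure (density lborel (\<lambda>z. ennreal (p z))) A
      - measure (density lborel (\<lambda>z. ennreal (q z))) A = (\<integral>z. r z * indicator A z \<partial>lborel)"
    if [measurable]: "A \<in> sets borel" for A
  proof -
    have "(\<integral>z. r z * indicator A z \<partial>lborel)
        = (\<integral>z. p z * indicator A z - q z * indicator A z \<partial>lborel)"
      by (simp add: r_def algebra_simps)
    also have "\<dots> = (\<integral>z. p z * indicator A z \<partial>lborel) - (\<integral>z. q z * indicator A z \<partial>lborel)"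
      using p q by (intro Bochner_Integration.integral_diff integrable_real_mult_indicator) auto
    finally show ?thesis using p q by (simp add: meas)
  qed
  have neg: "(\<integral>z. max 0 (- r z) \<partial>lborel) = (\<integral>z. max 0 (r z) \<partial>lborel)"
  proof -
    have "(\<integral>z. max 0 (r z) \<partial>lborel) - (\<integral>z. max 0 (- r z) \<partial>lborel)
        = (\<integral>z. max 0 (r z) - max 0 (- r z) \<partial>lborel)"
      using r by (intro Bochner_Integration.integral_diff[symmetric] integrable_max) auto
    also have "\<dots> = (\<integral>z. r z \<partial>lborel)"
      by (intro Bochner_Integration.integral_cong) auto
    finally show ?thesis using r0 by simp
  qed
  \<comment> \<open>On \<open>A\<close>, \<open>r\<close> is at most its positive part and
    \<open>- r\<close> at most its negative part; off \<open>A\<close> both sides compare with 0. By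
    \<open>neg\<close> the two parts have the same integral.\<close>
  have le: "\<bar>\<integral>z. r z * indicator A z \<partial>lborel\<bar> \<le> (\<integral>z. max 0 (r z) \<partial>lborel)"
    if [measurable]: "A \<in> sets borel" for A
  proof -
    have rA: "integrable lborel (\<lambda>z. r z * indicator A z)"
      using r by (intro integrable_real_mult_indicator) auto
    have "(\<integral>z. r z * indicator A z \<partial>lborel) \<le> (\<integral>z. max 0 (r z) \<partial>lborel)"
      using r rA by (intro integral_mono integrable_max) (auto simp: indicator_def)
    moreover have "(\<integral>z. - (r z * indicator A z) \<partial>lborel) \<le> (\<integral>z. max 0 (- r z) \<partial>lborel)"
      using r rA by (intro integral_mono integrable_max integrable_minus) (auto simp: indicator_def)
    ultimately show ?thesis by (simp add: neg abs_le_iff)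
  qed
  define A where "A = {z. r z > 0}"
  have A [measurable]: "A \<in> sets borel" unfolding A_def by measurable
  have attained: "(\<integral>z. r z * indicator A z \<partial>lborel) = (\<integral>z. max 0 (r z) \<partial>lborel)"
    by (intro Bochner_Integration.integral_cong) (auto simp: A_def indicator_def)
  have "(SUP A \<in> sets borel. \<bar>\<integral>z. r z * indicator A z \<partial>lborel\<bar>) = (\<integral>z. max 0 (r z) \<partial>lborel)"
  proof (rule cSup_eq_maximum)
    have "(\<integral>z. max 0 (r z) \<partial>lborel) \<ge> 0" by (intro integral_nonneg_AE) auto
    then show "(\<integral>z. max 0 (r z) \<partial>lborel)
        \<in> (\<lambda>A. \<bar>\<integral>z. r z * indicator A z \<partial>lborel\<bar>) ` sets borel"
      using A attained by (intro image_eqI[of _ _ A]) auto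
  qed (use le in auto)
  then show ?thesis unfolding tv_dist_def by (simp add: diff r_def)
qed

section \<open>The isotropic Gaussian density\<close>

lemma gauss_dens_nonneg [simp]: "gauss_dens \<sigma> x \<ge> 0"
  by (simp add: gauss_dens_def)

text \<open>The exponential factor is at most 1. Boundedness makes the density integrable against
  every Borel probability measure.\<close>

lemma gauss_dens_le: "gauss_dens \<sigma> (x :: real ^ 'd) \<le> (2 * pi * \<sigma>\<^sup>2) powr (- real CARD('d) / 2)"
  unfolding gauss_dens_def by (intro mult_left_le) auto

lemma measurable_gauss_dens [measurable]: "gauss_dens \<sigma> \<in> borel_measurable borel"
  unfolding gauss_dens_def by measurable

text \<open>The squared norm is a sum over coordinates, so its exponential factors. This reduces the
  total mass to that of one-dimensional normal densities.\<close>

lemma gauss_dens_eq_prod: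
  assumes "\<sigma> > 0"
  shows "gauss_dens \<sigma> (x :: real ^ 'd) = (\<Prod>b\<in>Basis. normal_density 0 \<sigma> (x \<bullet> b))"
proof -
  have "(norm x)\<^sup>2 = (\<Sum>b\<in>Basis. (x \<bullet> b)\<^sup>2)"
    unfolding dot_square_norm[symmetric] by (subst euclidean_inner) (simp add: power2_eq_square)
  then have e: "- (norm x)\<^sup>2 / (2 * \<sigma>\<^sup>2) = (\<Sum>b\<in>Basis. - (x \<bullet> b)\<^sup>2 / (2 * \<sigma>\<^sup>2))"
    by (simp add: sum_negf sum_divide_distrib)
  \<comment> \<open>Each of the \<open>CARD('d)\<close> coordinates contributes one normalising
    factor, the power \<open>- 1 / 2\<close> of the variance term.\<close>
  have pw: "(1 / sqrt (2 * pi * \<sigma>\<^sup>2)) ^ CARD('d) = (2 * pi * \<sigma>\<^sup>2) powr (- real CARD('d) / 2)"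
  proof -
    define a where "a = 2 * pi * \<sigma>\<^sup>2"
    have a: "a > 0" using assms by (simp add: a_def)
    have "1 / sqrt a = a powr (- (1 / 2))"
      using a by (simp only: powr_minus_divide powr_half_sqrt[OF less_imp_le])
    then have "(1 / sqrt a) ^ CARD('d) = a powr (- (1 / 2) * real CARD('d))"
      using a by (simp only: powr_power simp_thms less_imp_neq[symmetric] mult.commute)
    then show ?thesis by (simp add: a_def)
  qed
  have "gauss_dens \<sigma> x = (1 / sqrt (2 * pi * \<sigma>\<^sup>2)) ^ CARD('d)
      * (\<Prod>b\<in>Basis. exp (- (x \<bullet> b)\<^sup>2 / (2 * \<sigma>\<^sup>2)))"
    unfolding gauss_dens_def e pw by (simp only: exp_sum finite_Basis)
  then show ?thesis
    by (simp add: normal_density_def prod_dividef power_one_over)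
qed

lemma nn_integral_gauss_dens:
  assumes "\<sigma> > 0"
  shows "(\<integral>\<^sup>+z. ennreal (gauss_dens \<sigma> (z :: real ^ 'd)) \<partial>lborel) = 1"
proof -
  have "(\<integral>\<^sup>+z. ennreal (gauss_dens \<sigma> (z :: real ^ 'd)) \<partial>lborel)
      = (\<integral>\<^sup>+z. (\<Prod>b\<in>Basis. ennreal (normal_density 0 \<sigma> (z \<bullet> b))) \<partial>(lborel :: (real ^ 'd) measure))"
    by (simp add: gauss_dens_eq_prod[OF assms] prod_ennreal)
  also have "\<dots> = (\<Prod>b\<in>(Basis :: (real ^ 'd) set). \<integral>\<^sup>+z. ennreal (normal_density 0 \<sigma> z) \<partial>lborel)"
    by (rule nn_integral_lborel_prod) auto
  also have "(\<integral>\<^sup>+z. ennreal (normal_density 0 \<sigma> z) \<partial>lborel) = 1"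
    using assms by (subst nn_integral_eq_integral) auto
  finally show ?thesis by simp
qed

lemma nn_integral_lborel_translate:
  fixes x :: "'a :: euclidean_space"
  assumes [measurable]: "f \<in> borel_measurable borel"
  shows "(\<integral>\<^sup>+z. f (x + z) \<partial>lborel) = (\<integral>\<^sup>+z. f z \<partial>lborel)"
  by (subst (2) lborel_distr_plus[of x, symmetric]) (simp add: nn_integral_distr)

lemma nn_integral_gauss_dens_shift:
  fixes x :: "real ^ 'd"
  assumes "\<sigma> > 0"
  shows "(\<integral>\<^sup>+z. ennreal (gauss_dens \<sigma> (z - x)) \<partial>lborel) = 1"
  using nn_integral_lborel_translate[of "\<lambda>z. ennreal (gauss_dens \<sigma> (z - x))" x]
    nn_integral_gauss_dens[OF assms, where 'd = 'd] by simp

lemma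
  fixes x :: "real ^ 'd"
  assumes "\<sigma> > 0"
  shows integrable_gauss_dens_shift: "integrable lborel (\<lambda>z. gauss_dens \<sigma> (z - x))"
    and integral_gauss_dens_shift: "(\<integral>z. gauss_dens \<sigma> (z - x) \<partial>lborel) = 1"
  using nn_integral_gauss_dens_shift[OF assms, of x]
  by (auto intro!: integrableI_nonneg simp: integral_eq_nn_integral)

lemma prob_space_gauss_measure:
  "\<sigma> > 0 \<Longrightarrow> prob_space (gauss_measure \<sigma> :: (real ^ 'd) measure)"
  unfolding gauss_measure_def
  by (intro prob_spaceI) (simp add: emeasure_density nn_integral_gauss_dens)

section \<open>Densities of measures smoothed by a Gaussian\<close>

text \<open>For a Borel probability measure \<open>Q\<close> and positive \<open>\<sigma>\<close>,
  this is the Lebesgue density of the convolution of \<open>Q\<close> with the Gaussian.\<close>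

definition smooth_dens :: "real \<Rightarrow> (real ^ 'd) measure \<Rightarrow> real ^ 'd \<Rightarrow> real" where
  "smooth_dens \<sigma> Q z = (\<integral>y. gauss_dens \<sigma> (z - y) \<partial>Q)"

lemma smooth_dens_nonneg [simp]: "smooth_dens \<sigma> Q z \<ge> 0"
  unfolding smooth_dens_def by (intro integral_nonneg_AE) auto

context
  fixes \<sigma> :: real and Q :: "(real ^ 'd) measure"
  assumes \<sigma>: "\<sigma> > 0" and Q: "prob_space Q" and sets_Q [measurable_cong]: "sets Q = sets borel"
begin

interpretation Q: prob_space Q by (rule Q)

interpretation pair_sigma_finite Q "lborel :: (real ^ 'd) measure"
  by (intro pair_sigma_finite.intro Q.sigma_finite_measure_axioms sigma_finite_lborel)

lemma measurable_smooth_dens: "smooth_dens \<sigma> Q \<in> borel_measurable borel"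
  unfolding smooth_dens_def by measurable

text \<open>The integrand is bounded and \<open>Q\<close> is finite, so the real integral is genuine
  and may be replaced by the nonnegative one, to which Tonelli applies.\<close>

lemma ennreal_smooth_dens: "ennreal (smooth_dens \<sigma> Q z) = (\<integral>\<^sup>+y. ennreal (gauss_dens \<sigma> (z - y)) \<partial>Q)"
proof -
  have "integrable Q (\<lambda>y. gauss_dens \<sigma> (z - y))"
    by (rule Q.integrable_const_bound[where B = "(2 * pi * \<sigma>\<^sup>2) powr (- real CARD('d) / 2)"])
       (auto intro!: AE_I2 simp: gauss_dens_le[simplified])
  then show ?thesis
    unfolding smooth_dens_def by (intro nn_integral_eq_integral[symmetric]) auto
qed

text \<open>Translation invariance of Lebesgue measure moves the shift by \<open>x\<close> from the
  set \<open>A\<close> into the density; Tonelli then integrates out \<open>x\<close> first.\<close>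

lemma convolution_gauss_measure:
  "Q \<star> gauss_measure \<sigma> = density lborel (\<lambda>z. ennreal (smooth_dens \<sigma> Q z))"
proof (rule measure_eqI)
  fix A assume "A \<in> sets (Q \<star> gauss_measure \<sigma>)"
  then have A [measurable]: "A \<in> sets borel" by simp
  interpret G: prob_space "gauss_measure \<sigma> :: (real ^ 'd) measure"
    by (rule prob_space_gauss_measure[OF \<sigma>])
  note [measurable] = measurable_smooth_dens
  have "emeasure (Q \<star> gauss_measure \<sigma>) A = (\<integral>\<^sup>+x. \<integral>\<^sup>+y. indicator A (x + y) \<partial>gauss_measure \<sigma> \<partial>Q)"
    by (intro convolution_emeasure' Q.finite_measure_axioms G.finite_measure_axioms sets_Q A)
       (simp add: gauss_measure_def)
  also have "\<dots> = (\<integral>\<^sup>+x. \<integral>\<^sup>+z. ennreal (gauss_dens \<sigma> (z - x)) * indicator A z \<partial>lborel \<partial>Q)"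
  proof (intro nn_integral_cong)
    fix x
    show "(\<integral>\<^sup>+y. indicator A (x + y) \<partial>gauss_measure \<sigma>)
        = (\<integral>\<^sup>+z. ennreal (gauss_dens \<sigma> (z - x)) * indicator A z \<partial>lborel)"
      using nn_integral_lborel_translate[of "\<lambda>z. ennreal (gauss_dens \<sigma> (z - x)) * indicator A z" x]
      unfolding gauss_measure_def by (subst nn_integral_density) auto
  qed
  also have "\<dots> = (\<integral>\<^sup>+z. \<integral>\<^sup>+x. ennreal (gauss_dens \<sigma> (z - x)) * indicator A z \<partial>Q \<partial>lborel)"
    by (rule Fubini'[symmetric]) measurable
  also have "\<dots> = (\<integral>\<^sup>+z. ennreal (smooth_dens \<sigma> Q z) * indicator A z \<partial>lborel)"
    by (intro nn_integral_cong) (simp add: nn_integral_multc ennreal_smooth_dens)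
  also have "\<dots> = emeasure (density lborel (\<lambda>z. ennreal (smooth_dens \<sigma> Q z))) A"
    by (subst emeasure_density) auto
  finally show "emeasure (Q \<star> gauss_measure \<sigma>) A
      = emeasure (density lborel (\<lambda>z. ennreal (smooth_dens \<sigma> Q z))) A" .
qed simp

text \<open>By Tonelli the total mass is the \<open>Q\<close>-average of the masses of shifted
  Gaussians, each equal to 1. This supplies the equal masses required by
  \<open>tv_dist_density\<close>.\<close>

lemma
  shows integrable_smooth_dens: "integrable lborel (smooth_dens \<sigma> Q)"
    and integral_smooth_dens: "integral\<^sup>L lborel (smooth_dens \<sigma> Q) = 1"
proof -
  note [measurable] = measurable_smooth_dens
  have "(\<integral>\<^sup>+z. ennreal (smooth_dens \<sigma> Q z) \<partial>lborel)
      = (\<integral>\<^sup>+x. \<integral>\<^sup>+z. ennreal (gauss_dens \<sigma> (z - x)) \<partial>lborel \<partial>Q)"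
    unfolding ennreal_smooth_dens by (rule Fubini') measurable
  also have "\<dots> = 1" by (simp add: nn_integral_gauss_dens_shift[OF \<sigma>] Q.emeasure_space_1)
  finally have *: "(\<integral>\<^sup>+z. ennreal (smooth_dens \<sigma> Q z) \<partial>lborel) = 1" .
  then show "integrable lborel (smooth_dens \<sigma> Q)" by (intro integrableI_nonneg) auto
  show "integral\<^sup>L lborel (smooth_dens \<sigma> Q) = 1"
    using * by (subst integral_eq_nn_integral) auto
qed

end

lemma smooth_tv_eq_integral:
  fixes P Q :: "(real ^ 'd) measure"
  assumes "\<sigma> > 0" "prob_space Q" "sets Q = sets borel" "prob_space P" "sets P = sets borel"
  shows "smooth_tv \<sigma> Q P = (\<integral>z. max 0 (smooth_dens \<sigma> Q z - smooth_dens \<sigma> P z) \<partial>lborel)"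
  unfolding smooth_tv_def
  by (simp add: assms convolution_gauss_measure tv_dist_density integrable_smooth_dens
      integral_smooth_dens)

section \<open>The empirical measure\<close>

text \<open>Both sides count the indices \<open>i < n\<close> with \<open>x i\<close> in
  \<open>A\<close> and divide by \<open>n\<close>. Seen as the law of \<open>x\<close> at a
  uniformly drawn index, the empirical measure is a probability measure and integrals against it are
  finite averages. The index set must be nonempty for the uniform distribution.\<close>

lemma empirical_eq_distr:
  assumes "n \<ge> 1"
  shows "empirical n x = distr (measure_pmf (pmf_of_set {..<n})) borel x"
proof (rule measure_eqI)
  fix A assume "A \<in> sets (empirical n x)"
  then have A: "A \<in> sets borel" by simp
  have ne: "{..<n} \<noteq> {}" using assms by (simp add: lessThan_empty_iff)
  have "(\<Sum>i<n. emeasure (return borel (x i)) A) = of_nat (card ({..<n} \<inter> x -` A))"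
    using A by (simp add: indicator_def sum.If_cases vimage_def Int_def)
  then show "emeasure (empirical n x) A = emeasure (distr (measure_pmf (pmf_of_set {..<n})) borel x) A"
    using A ne assms
    by (simp add: emeasure_empirical emeasure_distr emeasure_pmf_of_set divide_ennreal
        ennreal_of_nat_eq_real_of_nat)
qed simp

lemma prob_space_empirical: "n \<ge> 1 \<Longrightarrow> prob_space (empirical n x)"
  unfolding empirical_eq_distr by (intro measure_pmf.prob_space_distr) auto

lemma smooth_dens_empirical:
  assumes "n \<ge> 1"
  shows "smooth_dens \<sigma> (empirical n x) z = (\<Sum>i<n. gauss_dens \<sigma> (z - x i)) / real n"
proof -
  have ne: "{..<n} \<noteq> {}" using assms by (simp add: lessThan_empty_iff)
  show ?thesis
    using ne unfolding smooth_dens_def empirical_eq_distr[OF assms]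
    by (subst integral_distr) (auto simp: integral_pmf_of_set)
qed

section \<open>Measurability and bounded differences of the smoothed distance\<close>

context
  fixes \<sigma> :: real and P :: "(real ^ 'd) measure" and n :: nat
  assumes \<sigma>: "\<sigma> > 0" and P: "prob_space P" "sets P = sets borel" and n: "n \<ge> 1"
begin

lemma smooth_tv_empirical:
  "smooth_tv \<sigma> (empirical n x) P
     = (\<integral>z. max 0 ((\<Sum>i<n. gauss_dens \<sigma> (z - x i)) / real n - smooth_dens \<sigma> P z) \<partial>lborel)"
  using n by (simp add: smooth_tv_eq_integral \<sigma> P prob_space_empirical smooth_dens_empirical)

lemma integrable_smooth_tv_empirical:
  "integrable lborel (\<lambda>z. max 0 ((\<Sum>i<n. gauss_dens \<sigma> (z - x i)) / real n - smooth_dens \<sigma> P z))"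
  by (intro integrable_max Bochner_Integration.integrable_diff integrable_divide_zero
      Bochner_Integration.integrable_sum integrable_gauss_dens_shift integrable_smooth_dens \<sigma> P) auto

text \<open>A supremum over the uncountable family of Borel sets is not evidently measurable in the
  sample. The density formula replaces it by a parameter integral of a jointly measurable
  function.\<close>

lemma measurable_smooth_tv_empirical:
  "(\<lambda>x. smooth_tv \<sigma> (empirical n x) P) \<in> borel_measurable (PiM {..<n} (\<lambda>_. borel))"
proof -
  note [measurable] = measurable_smooth_dens[OF \<sigma> P]
  show ?thesis unfolding smooth_tv_empirical by measurable
qed

text \<open>The positive part of a difference of nonnegative densities is at most the first density,
  whose integral is 1.\<close>

lemma smooth_tv_empirical_bounds: "\<bar>smooth_tv \<sigma> (empirical n x) P\<bar> \<le> 1"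
proof -
  have "smooth_tv \<sigma> (empirical n x) P \<le> integral\<^sup>L lborel (smooth_dens \<sigma> (empirical n x))"
    unfolding smooth_tv_eq_integral[OF \<sigma> prob_space_empirical[OF n] sets_empirical P]
    by (intro integral_mono integrable_max Bochner_Integration.integrable_diff
        integrable_smooth_dens \<sigma> P prob_space_empirical n) auto
  also have "\<dots> = 1" by (intro integral_smooth_dens \<sigma> prob_space_empirical n) auto
  moreover have "smooth_tv \<sigma> (empirical n x) P \<ge> 0"
    unfolding smooth_tv_empirical by (intro integral_nonneg_AE) auto
  ultimately show ?thesis by simp
qed

text \<open>Only the \<open>i\<close>-th summand changes. Dropping the new nonnegative summand
  leaves an excess of at most the old one over \<open>n\<close>; this survives taking positive parts
  and integrates to \<open>1 / n\<close>.\<close>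

lemma smooth_tv_empirical_update_le:
  assumes i: "i < n"
  shows "smooth_tv \<sigma> (empirical n x) P \<le> smooth_tv \<sigma> (empirical n (x(i := y))) P + 1 / real n"
proof -
  have sum_split: "(\<Sum>j<n. gauss_dens \<sigma> (z - w j))
      = gauss_dens \<sigma> (z - w i) + (\<Sum>j\<in>{..<n} - {i}. gauss_dens \<sigma> (z - w j))" for w z
    using i by (subst sum.remove[of _ i]) auto
  have "smooth_tv \<sigma> (empirical n x) P
      \<le> (\<integral>z. max 0 ((\<Sum>j<n. gauss_dens \<sigma> (z - (x(i := y)) j)) / real n - smooth_dens \<sigma> P z)
            + gauss_dens \<sigma> (z - x i) / real n \<partial>lborel)"
    unfolding smooth_tv_empirical
  proof (intro integral_mono integrable_smooth_tv_empirical Bochner_Integration.integrable_add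
      integrable_divide_zero integrable_gauss_dens_shift \<sigma>)
    fix z
    have "(\<Sum>j\<in>{..<n} - {i}. gauss_dens \<sigma> (z - (x(i := y)) j))
        = (\<Sum>j\<in>{..<n} - {i}. gauss_dens \<sigma> (z - x j))"
      by (intro sum.cong) auto
    then have "(\<Sum>j<n. gauss_dens \<sigma> (z - x j)) / real n
        \<le> (\<Sum>j<n. gauss_dens \<sigma> (z - (x(i := y)) j)) / real n + gauss_dens \<sigma> (z - x i) / real n"
      unfolding sum_split add_divide_distrib by simp
    then show "max 0 ((\<Sum>j<n. gauss_dens \<sigma> (z - x j)) / real n - smooth_dens \<sigma> P z)
        \<le> max 0 ((\<Sum>j<n. gauss_dens \<sigma> (z - (x(i := y)) j)) / real n - smooth_dens \<sigma> P z)
          + gauss_dens \<sigma> (z - x i) / real n"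
      by (auto simp: max_def)
  qed
  also have "\<dots> = smooth_tv \<sigma> (empirical n (x(i := y))) P + 1 / real n"
    unfolding smooth_tv_empirical
    by (subst Bochner_Integration.integral_add)
       (auto simp del: fun_upd_apply simp: integral_gauss_dens_shift[OF \<sigma>]
         intro!: integrable_smooth_tv_empirical integrable_gauss_dens_shift \<sigma>)
  finally show ?thesis .
qed

text \<open>Overwriting coordinate \<open>i\<close> with its old value \<open>x i\<close> restores
  \<open>x\<close>, so the one-sided bound also holds in reverse.\<close>

lemma smooth_tv_empirical_bounded_difference:
  assumes "i < n"
  shows "\<bar>smooth_tv \<sigma> (empirical n x) P - smooth_tv \<sigma> (empirical n (x(i := y))) P\<bar> \<le> 1 / real n"
  using smooth_tv_empirical_update_le[OF assms, of x y]
    smooth_tv_empirical_update_le[OF assms, of "x(i := y)" "x i"] by simp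

end

section \<open>Concentration for an i.i.d. sample\<close>

theorem corollary1:
  fixes \<sigma> :: real
    and P :: "(real ^ 'd) measure"
    and M :: "'w measure"
    and X :: "nat \<Rightarrow> 'w \<Rightarrow> real ^ 'd"
  assumes "\<sigma> > 0"
    and "prob_space P" and "sets P = sets borel"
    and "prob_space M"
    and "prob_space.indep_vars M (\<lambda>_. borel) X UNIV"
    and "\<And>i. distr M borel (X i) = P"
    and "(\<integral>\<^sup>+ x. ennreal (sqrt (prob_space.variance P (\<lambda>y. gauss_dens \<sigma> (x - y)))) \<partial>lborel) < \<infinity>"
  shows "\<forall>n\<ge>1. \<forall>t>0.
    measure M {\<omega> \<in> space M.
      smooth_tv \<sigma> (empirical n (\<lambda>i. X i \<omega>)) P
        \<ge> integral\<^sup>L M (\<lambda>\<omega>'. smooth_tv \<sigma> (empirical n (\<lambda>i. X i \<omega>')) P) + t}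
    \<le> exp (- real n * t\<^sup>2 / 2)"
proof (intro allI impI)
  fix n :: nat and t :: real
  assume n: "n \<ge> 1" and t: "t > 0"
  interpret M: prob_space M by (rule assms)
  have X [measurable]: "X i \<in> borel_measurable M" for i
    using assms(5) unfolding M.indep_vars_def by auto
  note base = assms(1-3) n
  define F where "F x = smooth_tv \<sigma> (empirical n x) P" for x
  \<comment> \<open>Points of the product space are \<open>undefined\<close> outside the index set,
    hence the restriction. The distance reads only the first \<open>n\<close> points, so it is
    unaffected (\<open>FY\<close>).\<close>
  define Y where "Y \<omega> = (\<lambda>i\<in>{..<n}. X i \<omega>)" for \<omega>
  have sets_PiM: "sets (PiM {..<n} (\<lambda>_. P)) = sets (PiM {..<n} (\<lambda>_. borel))"
    by (intro sets_PiM_cong) (auto simp: assms)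
  have F: "F \<in> borel_measurable (PiM {..<n} (\<lambda>_. borel))"
    unfolding F_def by (rule measurable_smooth_tv_empirical[OF base])
  have F_P: "F \<in> borel_measurable (PiM {..<n} (\<lambda>_. P))"
    using F by (simp cong: measurable_cong_sets add: measurable_cong_sets[OF sets_PiM refl])
  have Y: "Y \<in> M \<rightarrow>\<^sub>M PiM {..<n} (\<lambda>_. borel)"
    unfolding Y_def by measurable
  have FY: "F (\<lambda>i. X i \<omega>) = F (Y \<omega>)" for \<omega>
    unfolding F_def smooth_tv_empirical[OF base] Y_def by simp
  \<comment> \<open>Independence and the common marginal \<open>P\<close> make the joint law of the
    first \<open>n\<close> variables the product measure; \<open>n \<ge> 1\<close> keeps the index
    set nonempty.\<close>
  have "M.indep_vars (\<lambda>_. borel) X {..<n}"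
    using assms(5) by (rule M.indep_vars_subset) auto
  then have distr_Y: "distr M (PiM {..<n} (\<lambda>_. borel)) Y = PiM {..<n} (\<lambda>_. P)"
    using n by (subst (asm) M.indep_vars_iff_distr_eq_PiM') (auto simp: lessThan_empty_iff assms(6) Y_def[abs_def])
  have EF: "(\<integral>\<omega>. F (Y \<omega>) \<partial>M) = integral\<^sup>L (PiM {..<n} (\<lambda>_. P)) F"
    unfolding distr_Y[symmetric] by (rule integral_distr[symmetric, OF Y F])
  have "measure M {\<omega> \<in> space M. F (Y \<omega>) \<ge> (\<integral>\<omega>. F (Y \<omega>) \<partial>M) + t}
      = measure (PiM {..<n} (\<lambda>_. P)) {x \<in> space (PiM {..<n} (\<lambda>_. P)).
          F x \<ge> integral\<^sup>L (PiM {..<n} (\<lambda>_. P)) F + t}" (is "_ = measure ?Pn ?S")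
  proof -
    have "?S \<in> sets ?Pn" using F_P by measurable
    then have "?S \<in> sets (PiM {..<n} (\<lambda>_. borel))" by (simp add: sets_PiM)
    then have "measure ?Pn ?S = measure M (Y -` ?S \<inter> space M)"
      unfolding distr_Y[symmetric] by (intro measure_distr Y) simp
    also have "Y -` ?S \<inter> space M = {\<omega> \<in> space M. F (Y \<omega>) \<ge> (\<integral>\<omega>. F (Y \<omega>) \<partial>M) + t}"
      using measurable_space[OF Y] sets_eq_imp_space_eq[OF sets_PiM] by (auto simp: EF)
    finally show ?thesis by simp
  qed
  \<comment> \<open>With \<open>c i = 1 / n\<close>, the squares sum to
    \<open>1 / n\<close>.\<close>
  also have "\<dots> \<le> exp (- 2 * t\<^sup>2 / (\<Sum>i\<in>{..<n}. (1 / real n)\<^sup>2))"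
  proof (rule McDiarmid_ineq_PiM[where B = 1])
    show "(\<Sum>i\<in>{..<n}. (1 / real n)\<^sup>2) > 0" using n by simp
  qed (use F_P t assms(2) in \<open>auto simp del: fun_upd_apply simp: F_def
        intro: smooth_tv_empirical_bounds[OF base] smooth_tv_empirical_bounded_difference[OF base]\<close>)
  also have "\<dots> = exp (- 2 * real n * t\<^sup>2)"
    using n by (simp add: power2_eq_square field_simps)
  \<comment> \<open>The exponent obtained is four times the one claimed.\<close>
  also have "\<dots> \<le> exp (- real n * t\<^sup>2 / 2)" by simp
  finally show "measure M {\<omega> \<in> space M.
      smooth_tv \<sigma> (empirical n (\<lambda>i. X i \<omega>)) P
        \<ge> integral\<^sup>L M (\<lambda>\<omega>'. smooth_tv \<sigma> (empirical n (\<lambda>i. X i \<omega>')) P) + t}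
    \<le> exp (- real n * t\<^sup>2 / 2)"
    using FY by (simp add: F_def)
qed

end
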